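(* Let $n \geq 2$, let $Y_1, \dots, Y_n$ be independent random variables with common distribution $N(\mu, \sigma^2)$, let $\overline{Y} = \frac{1}{n}\sum_{i=1}^n Y_i$, and let $R_j = Y_j - \overline{Y}$ for $j = 1, \dots, n$. Let $$W_j = R_{j+1} - \frac{1}{\sqrt{n}+1} R_1, \quad j = 1, \dots, n-1;$$ or let $$W_j = R_{j+1} + \frac{1}{\sqrt{n}-1} R_1, \quad j = 1, \dots, n-1.$$ Then (in either case) the $W_j$ are i.i.d. with $W_j \sim N(0, \sigma^2)$, and $\sum_{j=1}^{n-1} W_j^2 = \sum_{j=1}^{n} R_j^2$.
   Context: $N(\mu,\sigma^2)$ is the normal distribution with mean $\mu\in\mathbb{R}$ and variance $\sigma^2>0$. *)

theory Defs
  imports "HOL-Probability.Probability"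
begin

definition sample_mean :: "nat \<Rightarrow> (nat \<Rightarrow> 'a \<Rightarrow> real) \<Rightarrow> 'a \<Rightarrow> real" where
  "sample_mean n Y \<omega> = (1 / real n) * (\<Sum>i=1..n. Y i \<omega>)"

definition residual :: "nat \<Rightarrow> (nat \<Rightarrow> 'a \<Rightarrow> real) \<Rightarrow> nat \<Rightarrow> 'a \<Rightarrow> real" where
  "residual n Y j \<omega> = Y j \<omega> - sample_mean n Y \<omega>"

text \<open>The second argument is the standard deviation, as in \<^const>\<open>normal_density\<close>, so
  \<open>normal_distributed \<mu> \<sigma> M X\<close> says that \<open>X\<close> has law \<open>N(\<mu>, \<sigma>\<^sup>2)\<close>.\<close>

definition normal_distributed :: "real \<Rightarrow> real \<Rightarrow> 'a measure \<Rightarrow> ('a \<Rightarrow> real) \<Rightarrow> bool" where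
  "normal_distributed \<mu> \<sigma> M X \<longleftrightarrow> distributed M lborel X (\<lambda>x. ennreal (normal_density \<mu> \<sigma> x))"

end

theory Submission
  imports Defs
begin

text \<open>The two constants \<open>c = -1/(\<surd>n + 1)\<close> and \<open>c = 1/(\<surd>n - 1)\<close> are the solutions of
  \<open>n c\<^sup>2 = (1 + c)\<^sup>2\<close>. For such \<open>c\<close>, the projections of the vectors \<open>e\<^bsub>j+1\<^esub> + c e\<^sub>1\<close>
  onto the orthogonal complement of \<open>(1, \<dots>, 1)\<close> are orthonormal, and \<open>W\<^sub>j\<close> is the inner product
  of the \<open>j\<close>-th one with \<open>Y\<close>. The joint characteristic function of orthonormal
  combinations of i.i.d. normal variables factorises into characteristic functions of normal
  laws, and by Kac's theorem this factorisation implies independence.\<close>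

section \<open>From characteristic functions to independence\<close>

text \<open>The left side of \<open>char\<close> is the characteristic function of \<open>X\<close>
  under the probability measure with density \<open>h\<close>. Both laws of \<open>X\<close> thus
  have the same characteristic function, and Levy's uniqueness theorem identifies them.\<close>

lemma (in prob_space) distr_density_eqI_char:
  fixes h X :: "'a \<Rightarrow> real"
  assumes [measurable]: "h \<in> borel_measurable M" "random_variable borel X"
    and nonneg: "\<And>x. 0 \<le> h x" and int: "(LINT x|M. h x) = 1"
    and char: "\<And>u. (CLINT x|M. complex_of_real (h x) * iexp (u * X x)) = (CLINT x|M. iexp (u * X x))"
  shows "distr (density M (\<lambda>x. ennreal (h x))) borel X = distr M borel X"
proof (rule Levy_uniqueness)
  \<comment> \<open>A function that is not integrable has Bochner integral 0, so the value 1 forces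
    integrability.\<close>
  have "integrable M h"
    using int not_integrable_integral_eq by fastforce
  then have "emeasure (density M (\<lambda>x. ennreal (h x))) (space M) = 1"
    by (simp add: emeasure_density nn_integral_eq_integral nonneg int cong: nn_integral_cong)
  then interpret D: prob_space "density M (\<lambda>x. ennreal (h x))"
    by (intro prob_spaceI) simp
  show "real_distribution (distr (density M (\<lambda>x. ennreal (h x))) borel X)"
    by (rule D.real_distribution_distr) simp
  show "real_distribution (distr M borel X)"
    by simp
  show "char (distr (density M (\<lambda>x. ennreal (h x))) borel X) = char (distr M borel X)"
    using char by (simp add: fun_eq_iff char_def integral_distr integral_density nonneg scaleR_conv_of_real)
qed

text \<open>Adding a constant to \<open>g\<close> and rescaling turns \<open>g\<close> into a probability density, without
  affecting the hypothesis, which is linear in \<open>g\<close> and true for constants.\<close>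

lemma (in prob_space) expectation_indicator_eqI_char_real:
  fixes g X :: "'a \<Rightarrow> real"
  assumes [measurable]: "g \<in> borel_measurable M" "random_variable borel X" "A \<in> sets borel"
    and bound: "\<And>x. \<bar>g x\<bar> \<le> K"
    and char: "\<And>u. (CLINT x|M. complex_of_real (g x) * iexp (u * X x)) =
      complex_of_real (LINT x|M. g x) * (CLINT x|M. iexp (u * X x))"
  shows "(LINT x|M. g x * indicator A (X x)) = (LINT x|M. g x) * prob (X -` A \<inter> space M)"
proof -
  have intg: "integrable M g"
    using bound by (intro integrable_const_bound[of _ K]) auto
  have inte: "integrable M (\<lambda>x. iexp (u * X x))" for u
    by (intro integrable_iexp) auto
  have intge: "integrable M (\<lambda>x. complex_of_real (g x) * iexp (u * X x))" for u
    using bound by (intro integrable_const_bound[of _ K]) (auto simp: norm_mult simp del: of_real_mult)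
  have inti: "integrable M (\<lambda>x. indicator A (X x) :: real)"
    by (intro integrable_const_bound[of _ 1]) auto
  have intgi: "integrable M (\<lambda>x. g x * indicator A (X x))"
    using bound order_trans[OF abs_ge_zero bound]
    by (intro integrable_const_bound[of _ K]) (auto simp: abs_mult indicator_def)
  \<comment> \<open>\<open>m\<close> normalises the shifted function \<open>g x + (K + 1)\<close>.
    The shift is \<open>K + 1\<close> rather than \<open>K\<close> because the integral of
    \<open>g\<close> may equal \<open>- K\<close>, and \<open>m\<close> must be positive.\<close>
  define m where "m = (LINT x|M. g x) + (K + 1)"
  have "(LINT x|M. - K) \<le> (LINT x|M. g x)"
    using intg bound by (intro integral_mono) (auto simp: abs_le_iff minus_le_iff)
  then have m: "m > 0"
    by (simp add: m_def prob_space)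
  define h where "h x = (g x + (K + 1)) / m" for x
  have [measurable]: "h \<in> borel_measurable M"
    by (simp add: h_def[abs_def])
  have nonneg: "0 \<le> h x" for x
    using m bound[of x] by (auto simp: h_def abs_le_iff intro!: divide_nonneg_pos)
  have inth: "(LINT x|M. h x) = 1"
    using m intg by (simp add: h_def[abs_def] m_def prob_space)
  have "(CLINT x|M. complex_of_real (h x) * iexp (u * X x)) = (CLINT x|M. iexp (u * X x))" for u
  proof -
    have "(CLINT x|M. complex_of_real (h x) * iexp (u * X x)) =
      (CLINT x|M. (complex_of_real (g x) * iexp (u * X x) + of_real (K + 1) * iexp (u * X x)) / of_real m)"
      by (intro Bochner_Integration.integral_cong) (auto simp: h_def field_simps add_divide_distrib)
    also have "\<dots> = ((CLINT x|M. complex_of_real (g x) * iexp (u * X x)) + of_real (K + 1) * (CLINT x|M. iexp (u * X x))) / of_real m"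
      using inte[of u] intge[of u]
      by (subst integral_divide_zero, subst Bochner_Integration.integral_add) (auto simp del: of_real_mult)
    also have "\<dots> = of_real m * (CLINT x|M. iexp (u * X x)) / of_real m"
      by (subst char) (simp add: m_def algebra_simps)
    finally show ?thesis
      using m by simp
  qed
  from distr_density_eqI_char[OF _ _ nonneg inth this]
  have "measure (distr (density M (\<lambda>x. ennreal (h x))) borel X) A = measure (distr M borel X) A"
    by simp
  then have "measure (density M (\<lambda>x. ennreal (h x))) (X -` A \<inter> space M) = prob (X -` A \<inter> space M)"
    by (simp add: measure_distr)
  also have "measure (density M (\<lambda>x. ennreal (h x))) (X -` A \<inter> space M) =
      (LINT x|density M (\<lambda>x. ennreal (h x)). indicator (X -` A \<inter> space M) x)"
    by simp
  also have "\<dots> = (LINT x|M. h x * indicator A (X x))"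
    by (subst integral_density)
       (auto simp: nonneg indicator_def intro!: Bochner_Integration.integral_cong)
  also have "\<dots> = (LINT x|M. (g x * indicator A (X x) + (K + 1) * indicator A (X x)) / m)"
    by (intro Bochner_Integration.integral_cong) (auto simp: h_def field_simps)
  also have "\<dots> = ((LINT x|M. g x * indicator A (X x)) + (K + 1) * (LINT x|M. indicator A (X x))) / m"
    using inti intgi by simp
  also have "(LINT x|M. indicator A (X x) :: real) = (LINT x|M. indicator (X -` A \<inter> space M) x)"
    by (intro Bochner_Integration.integral_cong) (auto simp: indicator_def)
  finally show ?thesis
    using m by (simp add: m_def field_simps)
qed

text \<open>The real case applies to \<open>Re (g x)\<close> and \<open>Im (g x)\<close>: these are
  linear combinations of \<open>g\<close> and its conjugate, and the hypothesis \<open>char\<close>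
  passes from \<open>g\<close> to the conjugate.\<close>

lemma (in prob_space) expectation_indicator_eqI_char:
  fixes g :: "'a \<Rightarrow> complex" and X :: "'a \<Rightarrow> real"
  assumes [measurable]: "g \<in> borel_measurable M" "random_variable borel X" "A \<in> sets borel"
    and bound: "\<And>x. norm (g x) \<le> K"
    and char: "\<And>u. (CLINT x|M. g x * iexp (u * X x)) = (CLINT x|M. g x) * (CLINT x|M. iexp (u * X x))"
  shows "(CLINT x|M. g x * indicator A (X x)) = (CLINT x|M. g x) * prob (X -` A \<inter> space M)"
proof -
  have intg: "integrable M g"
    using bound by (intro integrable_const_bound[of _ K]) auto
  have intge: "integrable M (\<lambda>x. g x * iexp (u * X x))" for u
    using bound by (intro integrable_const_bound[of _ K]) (auto simp: norm_mult simp del: of_real_mult)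
  have intce: "integrable M (\<lambda>x. cnj (g x) * iexp (u * X x))" for u
    using integrable_cnj[OF intge[of "- u"]] by (simp add: exp_cnj)
  have intgi: "integrable M (\<lambda>x. g x * indicator A (X x))"
    using bound order_trans[OF norm_ge_zero bound]
    by (intro integrable_const_bound[of _ K]) (auto simp: norm_mult indicator_def)
  \<comment> \<open>Conjugate the hypothesis at \<open>- u\<close>, since conjugation turns
    \<open>iexp (- u * X x)\<close> into \<open>iexp (u * X x)\<close>.\<close>
  have charc: "(CLINT x|M. cnj (g x) * iexp (u * X x)) = cnj (CLINT x|M. g x) * (CLINT x|M. iexp (u * X x))" for u
  proof -
    have "(CLINT x|M. cnj (g x) * iexp (u * X x)) = cnj (CLINT x|M. g x * iexp (- u * X x))"
      unfolding Bochner_Integration.integral_cnj[symmetric]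
        by (simp add: exp_cnj del: Bochner_Integration.integral_cnj)
    also have "\<dots> = cnj (CLINT x|M. g x) * cnj (CLINT x|M. iexp (- u * X x))"
      unfolding char by simp
    also have "cnj (CLINT x|M. iexp (- u * X x)) = (CLINT x|M. iexp (u * X x))"
      unfolding Bochner_Integration.integral_cnj[symmetric]
        by (simp add: exp_cnj del: Bochner_Integration.integral_cnj)
    finally show ?thesis .
  qed
  have re: "(LINT x|M. Re (g x) * indicator A (X x)) = (LINT x|M. Re (g x)) * prob (X -` A \<inter> space M)"
  proof (rule expectation_indicator_eqI_char_real)
    show "\<bar>Re (g x)\<bar> \<le> K" for x
      using abs_Re_le_cmod bound order_trans by blast
    fix u
    have "(CLINT x|M. complex_of_real (Re (g x)) * iexp (u * X x)) =
       (CLINT x|M. (g x * iexp (u * X x) + cnj (g x) * iexp (u * X x)) / 2)"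
      by (intro Bochner_Integration.integral_cong)
         (auto simp: complex_add_cnj distrib_right[symmetric])
    also have "\<dots> = ((CLINT x|M. g x * iexp (u * X x)) + (CLINT x|M. cnj (g x) * iexp (u * X x))) / 2"
      using intge[of u] intce[of u] by (simp del: of_real_mult)
    also have "\<dots> = complex_of_real (Re (CLINT x|M. g x)) * (CLINT x|M. iexp (u * X x))"
      unfolding char charc distrib_right[symmetric] complex_add_cnj by simp
    finally show "(CLINT x|M. complex_of_real (Re (g x)) * iexp (u * X x)) =
       complex_of_real (LINT x|M. Re (g x)) * (CLINT x|M. iexp (u * X x))"
      using intg by simp
  qed auto
  have im: "(LINT x|M. Im (g x) * indicator A (X x)) = (LINT x|M. Im (g x)) * prob (X -` A \<inter> space M)"
  proof (rule expectation_indicator_eqI_char_real)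
    show "\<bar>Im (g x)\<bar> \<le> K" for x
      using abs_Im_le_cmod bound order_trans by blast
    fix u
    have "(CLINT x|M. complex_of_real (Im (g x)) * iexp (u * X x)) =
       (CLINT x|M. (g x * iexp (u * X x) - cnj (g x) * iexp (u * X x)) / (2 * \<i>))"
      by (intro Bochner_Integration.integral_cong)
         (auto simp: complex_diff_cnj left_diff_distrib[symmetric]
           mult.left_commute[of "complex_of_real (Im _)" \<i>])
    also have "\<dots> = ((CLINT x|M. g x * iexp (u * X x)) - (CLINT x|M. cnj (g x) * iexp (u * X x))) / (2 * \<i>)"
      using intge[of u] intce[of u]
      by (subst integral_divide_zero, subst Bochner_Integration.integral_diff) auto
    also have "\<dots> = complex_of_real (Im (CLINT x|M. g x)) * (CLINT x|M. iexp (u * X x))"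
      unfolding char charc left_diff_distrib[symmetric] complex_diff_cnj
      by (simp add: mult.left_commute[of "complex_of_real (Im _)" \<i>])
    finally show "(CLINT x|M. complex_of_real (Im (g x)) * iexp (u * X x)) =
       complex_of_real (LINT x|M. Im (g x)) * (CLINT x|M. iexp (u * X x))"
      using intg by simp
  qed auto
  have ind: "(indicator A y :: complex) = of_real (indicator A y)" for y
    by (simp add: indicator_def)
  show ?thesis
    using re im intg intgi unfolding ind
    by (intro complex_eqI) (simp_all flip: integral_Re integral_Im)
qed

text \<open>Kac's theorem. In the joint characteristic function, the exponentials are
  replaced by indicator functions one variable at a time.\<close>

theorem (in prob_space) indep_vars_char:
  fixes X :: "'i \<Rightarrow> 'a \<Rightarrow> real"
  assumes fin: "finite I" and rv: "\<And>i. i \<in> I \<Longrightarrow> random_variable borel (X i)"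
    and char: "\<And>t. (CLINT x|M. iexp (\<Sum>i\<in>I. t i * X i x)) = (\<Prod>i\<in>I. char (distr M borel (X i)) (t i))"
  shows "indep_vars (\<lambda>_. borel) X I"
proof -
  have char0: "char (distr M borel (X i)) 0 = 1" if "i \<in> I" for i
    using rv[OF that] by (intro real_distribution.char_zero) simp
  \<comment> \<open>Frequency 0 outside \<open>K\<close> restricts the hypothesis to the subfamily
    \<open>K\<close>, because each characteristic function is 1 at 0.\<close>
  have charK: "(CLINT x|M. iexp (\<Sum>i\<in>K. t i * X i x)) = (\<Prod>i\<in>K. char (distr M borel (X i)) (t i))"
    if "K \<subseteq> I" for K t
  proof -
    let ?t = "\<lambda>i. if i \<in> K then t i else 0"
    have "(\<Sum>i\<in>I. ?t i * X i x) = (\<Sum>i\<in>K. t i * X i x)" for x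
      using that fin by (intro sum.mono_neutral_cong_right) auto
    moreover have "(\<Prod>i\<in>I. char (distr M borel (X i)) (?t i)) = (\<Prod>i\<in>K. char (distr M borel (X i)) (t i))"
      using that fin by (intro prod.mono_neutral_cong_right) (auto simp: char0)
    ultimately show ?thesis
      using char[of ?t] by simp
  qed
  \<comment> \<open>The indices in \<open>J\<close> already carry indicators, those in
    \<open>K\<close> still carry exponentials. \<open>K\<close> and \<open>t\<close> are generalised
    in the induction on \<open>J\<close>, since the step treats the new index first as a member of
    \<open>K\<close>. With \<open>K\<close> empty this is the product formula for
    probabilities.\<close>
  have mixed: "(CLINT x|M. (\<Prod>j\<in>J. indicator (A j) (X j x)) * iexp (\<Sum>k\<in>K. t k * X k x)) =
      (\<Prod>j\<in>J. complex_of_real (prob (X j -` A j \<inter> space M))) * (\<Prod>k\<in>K. char (distr M borel (X k)) (t k))"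
    if "finite J" "J \<inter> K = {}" "J \<subseteq> I" "K \<subseteq> I" "\<And>j. j \<in> J \<Longrightarrow> A j \<in> sets borel" for J K A t
    using that
  proof (induction J arbitrary: K t)
    case empty
    then show ?case using charK by simp
  next
    case (insert a J)
    have a: "a \<in> I" "a \<notin> K" "a \<notin> J" and [measurable]: "random_variable borel (X a)" "A a \<in> sets borel"
      using insert rv by auto
    have finK: "finite K"
      using insert.prems fin finite_subset by blast
    have [measurable]: "random_variable borel (X k)" if "k \<in> K" for k
      using that insert.prems rv by blast
    have rvJ [measurable]: "random_variable borel (X j)" if "j \<in> J" for j
      using that insert.prems rv by blast
    have AJ [measurable]: "A j \<in> sets borel" if "j \<in> J" for j
      using that insert.prems by blast
    define g where "g x = (\<Prod>j\<in>J. indicator (A j) (X j x)) * iexp (\<Sum>k\<in>K. t k * X k x)" for x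
    have g: "(CLINT x|M. g x) = (\<Prod>j\<in>J. complex_of_real (prob (X j -` A j \<inter> space M))) *
        (\<Prod>k\<in>K. char (distr M borel (X k)) (t k))"
      unfolding g_def using insert.prems by (intro insert.IH) auto
    have "(CLINT x|M. g x * indicator (A a) (X a x)) = (CLINT x|M. g x) * prob (X a -` A a \<inter> space M)"
    proof (rule expectation_indicator_eqI_char)
      have "(\<lambda>x. indicator (A j) (X j x) :: complex) \<in> borel_measurable M" if "j \<in> J" for j
        using rvJ[OF that] AJ[OF that] by measurable
      then show "g \<in> borel_measurable M"
        unfolding g_def[abs_def] by measurable
      have "norm (\<Prod>j\<in>J. indicator (A j) (X j x) :: complex) \<le> 1" for x
        unfolding prod_norm[symmetric] by (intro prod_le_1) (auto simp: indicator_def)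
      then show "norm (g x) \<le> 1" for x
        by (simp add: g_def norm_mult del: of_real_sum)
      fix u
      \<comment> \<open>The induction hypothesis for \<open>insert a K\<close>, with frequency
        \<open>u\<close> at \<open>a\<close>, gives the factorisation of
        \<open>g x * iexp (u * X a x)\<close> that permits replacing this exponential by the
        indicator of \<open>A a\<close>.\<close>
      let ?t = "t(a := u)"
      have "(\<Sum>k\<in>insert a K. ?t k * X k x) = u * X a x + (\<Sum>k\<in>K. t k * X k x)" for x
        using a finK by (auto intro!: sum.cong)
      then have "(CLINT x|M. g x * iexp (u * X a x)) =
          (CLINT x|M. (\<Prod>j\<in>J. indicator (A j) (X j x)) * iexp (\<Sum>k\<in>insert a K. ?t k * X k x))"
        by (simp add: g_def exp_add[symmetric] distrib_left mult_ac add_ac del: of_real_sum of_real_mult)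
      also have "\<dots> = (\<Prod>j\<in>J. complex_of_real (prob (X j -` A j \<inter> space M))) *
          (\<Prod>k\<in>insert a K. char (distr M borel (X k)) (?t k))"
        using insert.prems insert.hyps by (intro insert.IH) auto
      also have "(\<Prod>k\<in>insert a K. char (distr M borel (X k)) (?t k)) =
          char (distr M borel (X a)) u * (\<Prod>k\<in>K. char (distr M borel (X k)) (t k))"
        using a finK by (auto intro!: prod.cong)
      also have "char (distr M borel (X a)) u = (CLINT x|M. iexp (u * X a x))"
        by (simp add: char_def integral_distr)
      finally show "(CLINT x|M. g x * iexp (u * X a x)) = (CLINT x|M. g x) * (CLINT x|M. iexp (u * X a x))"
        by (simp add: g mult_ac)
    qed auto
    then show ?case
      unfolding g using insert.hyps by (simp add: g_def mult_ac)
  qed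
  show ?thesis
    unfolding indep_vars_def2
  proof (intro conjI ballI indep_setsI)
    fix i assume "i \<in> I"
    then show "{X i -` A \<inter> space M |A. A \<in> sets borel} \<subseteq> events"
      using rv measurable_sets by blast
  next
    fix B J assume J: "J \<noteq> {}" "J \<subseteq> I" "finite J"
      and "\<forall>j\<in>J. B j \<in> {X j -` A \<inter> space M |A. A \<in> sets borel}"
    then obtain A where A: "\<And>j. j \<in> J \<Longrightarrow> A j \<in> sets borel" "\<And>j. j \<in> J \<Longrightarrow> B j = X j -` A j \<inter> space M"
      by (simp add: Bex_def) metis
    have "B j \<in> events" if "j \<in> J" for j
      using that A J rv measurable_sets by (metis subsetD)
    then have "(\<Inter>j\<in>J. B j) \<in> events"
      using J by (intro sets.finite_INT) auto
    then have "prob (\<Inter>j\<in>J. B j) = (LINT x|M. indicator (\<Inter>j\<in>J. B j) x)"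
      by (simp add: sets.Int_space_eq2)
    then have "complex_of_real (prob (\<Inter>j\<in>J. B j)) =
        (CLINT x|M. complex_of_real (indicator (\<Inter>j\<in>J. B j) x))"
      by simp
    also have "\<dots> = (CLINT x|M. (\<Prod>j\<in>J. indicator (A j) (X j x)))"
      using J A by (intro Bochner_Integration.integral_cong) (auto simp: indicator_def prod_zero_iff)
    also have "\<dots> = complex_of_real (\<Prod>j\<in>J. prob (B j))"
      using mixed[of J "{}" A] J A by simp
    finally show "prob (\<Inter>j\<in>J. B j) = (\<Prod>j\<in>J. prob (B j))"
      unfolding of_real_eq_iff .
  qed (use rv in auto)
qed

section \<open>Characteristic functions of normal laws and of their linear combinations\<close>

text \<open>An affine image of the standard normal law, whose characteristic function is
  known.\<close>

lemma char_normal_density: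
  assumes "\<sigma> > 0"
  shows "char (density lborel (normal_density \<mu> \<sigma>)) t = iexp (\<mu> * t) * complex_of_real (exp (- (\<sigma> * t)\<^sup>2 / 2))"
proof -
  let ?S = "density lborel std_normal_density"
  interpret S: real_distribution ?S
    by (rule real_dist_normal_dist)
  have "distributed ?S lborel (\<lambda>x. x) std_normal_density"
    by (simp add: distributed_def distr_id2)
  from S.normal_density_affine[OF this, of \<sigma> \<mu>]
  have "distributed ?S lborel (\<lambda>x. \<mu> + \<sigma> * x) (normal_density \<mu> \<sigma>)"
    using assms by simp
  then have "density lborel (normal_density \<mu> \<sigma>) = distr ?S lborel (\<lambda>x. \<mu> + \<sigma> * x)"
    by (simp add: distributed_def)
  then have "char (density lborel (normal_density \<mu> \<sigma>)) t = (CLINT x|?S. iexp (t * (\<mu> + \<sigma> * x)))"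
    by (simp add: char_def integral_distr)
  also have "\<dots> = (CLINT x|?S. iexp (\<mu> * t) * iexp ((\<sigma> * t) * x))"
    by (simp add: exp_add[symmetric] algebra_simps)
  also have "\<dots> = iexp (\<mu> * t) * char ?S (\<sigma> * t)"
    by (simp add: char_def)
  finally show ?thesis
    by (simp add: char_std_normal_distribution)
qed

text \<open>By independence the characteristic function of the sum is a product, and the exponents
  add up. The coefficients enter only through their sum and their sum of squares, which is why
  orthonormal combinations behave so simply.\<close>

lemma (in prob_space) char_sum_normal:
  fixes Y :: "'i \<Rightarrow> 'a \<Rightarrow> real"
  assumes fin: "finite I" and \<sigma>: "\<sigma> > 0" and indep: "indep_vars (\<lambda>_. borel) Y I"
    and normal: "\<And>i. i \<in> I \<Longrightarrow> distributed M lborel (Y i) (normal_density \<mu> \<sigma>)"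
  shows "(CLINT x|M. iexp (\<Sum>i\<in>I. b i * Y i x)) =
    iexp (\<mu> * (\<Sum>i\<in>I. b i)) * complex_of_real (exp (- \<sigma>\<^sup>2 * (\<Sum>i\<in>I. (b i)\<^sup>2) / 2))"
proof -
  have rv [measurable]: "random_variable borel (Y i)" if "i \<in> I" for i
    using indep that by (auto simp: indep_vars_def)
  have "indep_vars (\<lambda>_. borel) (\<lambda>i x. b i * Y i x) I"
    by (rule indep_vars_compose2[OF indep]) simp
  \<comment> \<open>Evaluation at 1 suffices, as the coefficients \<open>b i\<close> take the role
    of frequencies.\<close>
  then have "char (distr M borel (\<lambda>x. \<Sum>i\<in>I. b i * Y i x)) 1 = (\<Prod>i\<in>I. char (distr M borel (\<lambda>x. b i * Y i x)) 1)"
    by (rule char_distr_sum)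
  moreover have "char (distr M borel (\<lambda>x. \<Sum>i\<in>I. b i * Y i x)) 1 = (CLINT x|M. iexp (\<Sum>i\<in>I. b i * Y i x))"
    unfolding char_def by (subst integral_distr) auto
  moreover have "char (distr M borel (\<lambda>x. b i * Y i x)) 1 =
      iexp (\<mu> * b i) * complex_of_real (exp (- (\<sigma> * b i)\<^sup>2 / 2))" if "i \<in> I" for i
  proof -
    have "distr M borel (Y i) = distr M lborel (Y i)"
      by (rule distr_cong) auto
    then have "char (density lborel (normal_density \<mu> \<sigma>)) (b i) =
        char (distr M borel (Y i)) (b i)"
      using normal[OF that] by (simp add: distributed_def)
    also have "char (distr M borel (Y i)) (b i) = char (distr M borel (\<lambda>x. b i * Y i x)) 1"
      using rv[OF that] by (simp add: char_def integral_distr)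
    finally show ?thesis
      by (simp add: char_normal_density[OF \<sigma>])
  qed
  ultimately have "(CLINT x|M. iexp (\<Sum>i\<in>I. b i * Y i x)) =
      (\<Prod>i\<in>I. iexp (\<mu> * b i)) * complex_of_real (\<Prod>i\<in>I. exp (- (\<sigma> * b i)\<^sup>2 / 2))"
    by (simp add: prod.distrib cong: prod.cong)
  also have "(\<Prod>i\<in>I. iexp (\<mu> * b i)) = iexp (\<mu> * (\<Sum>i\<in>I. b i))"
    by (subst exp_sum[OF fin, symmetric]) (simp add: sum_distrib_left)
  also have "(\<Prod>i\<in>I. exp (- (\<sigma> * b i)\<^sup>2 / 2)) = exp (- \<sigma>\<^sup>2 * (\<Sum>i\<in>I. (b i)\<^sup>2) / 2)"
    by (subst exp_sum[OF fin, symmetric])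
       (simp add: sum_distrib_left sum_divide_distrib sum_negf power_mult_distrib)
  finally show ?thesis .
qed

text \<open>Expanding the square leaves the Gram matrix of the vectors \<open>a j\<close>, which is
  the identity.\<close>

lemma sum_power2_orthonormal:
  fixes a :: "'j \<Rightarrow> 'i \<Rightarrow> real"
  assumes "finite J"
    and "\<And>j k. j \<in> J \<Longrightarrow> k \<in> J \<Longrightarrow> (\<Sum>i\<in>I. a j i * a k i) = of_bool (j = k)"
  shows "(\<Sum>i\<in>I. (\<Sum>j\<in>J. t j * a j i)\<^sup>2) = (\<Sum>j\<in>J. (t j)\<^sup>2)"
proof -
  have "(\<Sum>i\<in>I. (\<Sum>j\<in>J. t j * a j i)\<^sup>2) = (\<Sum>i\<in>I. \<Sum>j\<in>J. \<Sum>k\<in>J. t j * t k * (a j i * a k i))"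
    by (simp add: power2_eq_square sum_product mult_ac)
  also have "\<dots> = (\<Sum>j\<in>J. \<Sum>k\<in>J. t j * t k * (\<Sum>i\<in>I. a j i * a k i))"
    unfolding sum_distrib_left by (subst sum.swap, intro sum.cong refl, subst sum.swap) simp
  also have "\<dots> = (\<Sum>j\<in>J. (t j)\<^sup>2)"
    using assms by (simp add: power2_eq_square sum.delta cong: sum.cong)
  finally show ?thesis .
qed

section \<open>Orthonormal combinations of i.i.d. normal variables\<close>

text \<open>A combination of the \<open>W j\<close> with frequencies \<open>t j\<close> is a
  combination of the \<open>Y i\<close> whose coefficients have sum of squares
  \<open>\<Sum>j\<in>J. (t j)\<^sup>2\<close>. The joint characteristic function therefore splits
  into one normal factor for each \<open>j\<close>. This yields the marginal laws by Levy uniqueness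
  and independence by \<open>indep_vars_char\<close>.\<close>

theorem (in prob_space) indep_normal_orthonormal_combination:
  fixes Y :: "'i \<Rightarrow> 'a \<Rightarrow> real" and a :: "'j \<Rightarrow> 'i \<Rightarrow> real"
  assumes finI: "finite I" and \<sigma>: "\<sigma> > 0" and indep: "indep_vars (\<lambda>_. borel) Y I"
    and normal: "\<And>i. i \<in> I \<Longrightarrow> distributed M lborel (Y i) (normal_density \<mu> \<sigma>)"
    and fin: "finite J"
    and orth: "\<And>j k. j \<in> J \<Longrightarrow> k \<in> J \<Longrightarrow> (\<Sum>i\<in>I. a j i * a k i) = of_bool (j = k)"
  defines "W \<equiv> (\<lambda>j x. \<Sum>i\<in>I. a j i * Y i x)"
  shows "indep_vars (\<lambda>_. borel) W J"
    and "\<And>j. j \<in> J \<Longrightarrow> distributed M lborel (W j) (normal_density (\<mu> * (\<Sum>i\<in>I. a j i)) \<sigma>)"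
proof -
  let ?m = "\<lambda>j. \<mu> * (\<Sum>i\<in>I. a j i)"
  have rvY [measurable]: "random_variable borel (Y i)" if "i \<in> I" for i
    using indep that by (auto simp: indep_vars_def)
  have rv [measurable]: "random_variable borel (W j)" for j
    unfolding W_def by measurable
  have joint: "(CLINT x|M. iexp (\<Sum>j\<in>J. t j * W j x)) =
      (\<Prod>j\<in>J. iexp (?m j * t j) * complex_of_real (exp (- (\<sigma> * t j)\<^sup>2 / 2)))" for t
  proof -
    have "(\<Sum>j\<in>J. t j * W j x) = (\<Sum>i\<in>I. (\<Sum>j\<in>J. t j * a j i) * Y i x)" for x
      unfolding W_def sum_distrib_left sum_distrib_right by (subst sum.swap) (simp add: mult_ac)
    then have "(CLINT x|M. iexp (\<Sum>j\<in>J. t j * W j x)) = iexp (\<mu> * (\<Sum>i\<in>I. \<Sum>j\<in>J. t j * a j i)) *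
        complex_of_real (exp (- \<sigma>\<^sup>2 * (\<Sum>j\<in>J. (t j)\<^sup>2) / 2))"
      by (simp only: char_sum_normal[OF finI \<sigma> indep normal] sum_power2_orthonormal[OF fin orth])
    also have "\<mu> * (\<Sum>i\<in>I. \<Sum>j\<in>J. t j * a j i) = (\<Sum>j\<in>J. ?m j * t j)"
      unfolding sum_distrib_left sum_distrib_right by (subst sum.swap) (simp add: mult_ac)
    also have "iexp (\<Sum>j\<in>J. ?m j * t j) = (\<Prod>j\<in>J. iexp (?m j * t j))"
      using fin by (simp add: exp_sum sum_distrib_left del: of_real_mult)
    also have "- \<sigma>\<^sup>2 * (\<Sum>j\<in>J. (t j)\<^sup>2) / 2 = (\<Sum>j\<in>J. - (\<sigma> * t j)\<^sup>2 / 2)"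
      by (simp add: sum_distrib_left sum_divide_distrib sum_negf power_mult_distrib)
    also have "exp \<dots> = (\<Prod>j\<in>J. exp (- (\<sigma> * t j)\<^sup>2 / 2))"
      using fin by (rule exp_sum)
    finally show ?thesis
      by (simp add: prod.distrib)
  qed
  have charW: "char (distr M borel (W j)) u = iexp (?m j * u) * complex_of_real (exp (- (\<sigma> * u)\<^sup>2 / 2))"
    if "j \<in> J" for j u
  proof -
    \<comment> \<open>The marginal is read off the joint formula by setting all frequencies but the
      \<open>j\<close>-th to 0; the other factors become 1.\<close>
    let ?t = "\<lambda>k. if k = j then u else 0"
    have eq: "?t k * y = (if k = j then u * y else 0)" for k y
      by simp
    have "(CLINT x|M. iexp (\<Sum>k\<in>J. ?t k * W k x)) = (CLINT x|M. iexp (u * W j x))"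
      using that fin unfolding eq by (simp add: sum.delta)
    moreover have "(\<Prod>k\<in>J. iexp (?m k * ?t k) * complex_of_real (exp (- (\<sigma> * ?t k)\<^sup>2 / 2))) =
      (\<Prod>k\<in>J. if k = j then iexp (?m j * u) * complex_of_real (exp (- (\<sigma> * u)\<^sup>2 / 2)) else 1)"
      by (intro prod.cong) auto
    ultimately show ?thesis
      using joint[of ?t] that fin by (simp add: char_def integral_distr prod.delta)
  qed
  show "indep_vars (\<lambda>_. borel) W J"
    using fin rv by (rule indep_vars_char) (simp only: joint charW cong: prod.cong)
  fix j assume j: "j \<in> J"
  have "real_distribution (density lborel (normal_density (?m j) \<sigma>))"
    using prob_space_normal_density[OF \<sigma>]
    by (simp add: real_distribution_def real_distribution_axioms_def)
  then have "distr M borel (W j) = density lborel (normal_density (?m j) \<sigma>)"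
    using j by (intro Levy_uniqueness) (auto simp: fun_eq_iff charW char_normal_density[OF \<sigma>])
  moreover have "distr M borel (W j) = distr M lborel (W j)"
    by (rule distr_cong) auto
  ultimately show "distributed M lborel (W j) (normal_density (?m j) \<sigma>)"
    by (simp add: distributed_def)
qed

section \<open>Application to the residuals\<close>

theorem corollary4:
  fixes M :: "'a measure" and n :: nat and \<mu> \<sigma> :: real
    and Y W :: "nat \<Rightarrow> 'a \<Rightarrow> real"
  assumes "prob_space M"
    and "n \<ge> 2"
    and "\<sigma> > 0"
    and "prob_space.indep_vars M (\<lambda>_. borel) Y {1..n}"
    and "\<forall>i\<in>{1..n}. normal_distributed \<mu> \<sigma> M (Y i)"
    and "(\<forall>j\<in>{1..n-1}. W j = (\<lambda>\<omega>. residual n Y (j + 1) \<omega> - 1 / (sqrt (real n) + 1) * residual n Y 1 \<omega>))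
       \<or> (\<forall>j\<in>{1..n-1}. W j = (\<lambda>\<omega>. residual n Y (j + 1) \<omega> + 1 / (sqrt (real n) - 1) * residual n Y 1 \<omega>))"
  shows "prob_space.indep_vars M (\<lambda>_. borel) W {1..n-1}
       \<and> (\<forall>j\<in>{1..n-1}. normal_distributed 0 \<sigma> M (W j))
       \<and> (\<forall>\<omega>\<in>space M. (\<Sum>j=1..n-1. (W j \<omega>)\<^sup>2) = (\<Sum>j=1..n. (residual n Y j \<omega>)\<^sup>2))"
proof -
  interpret prob_space M
    by fact
  define s where "s = sqrt (real n)"
  have n: "real n = s\<^sup>2"
    by (simp add: s_def)
  have s: "s > 1"
    using assms(2) by (simp add: s_def)
  \<comment> \<open>Both cases are treated at once through \<open>c\<close>. The first constant
    satisfies \<open>s * c = - (1 + c)\<close>, the second \<open>s * c = 1 + c\<close>; squaring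
    removes the sign.\<close>
  obtain c where W: "\<And>j. j \<in> {1..n-1} \<Longrightarrow> W j = (\<lambda>\<omega>. residual n Y (j + 1) \<omega> + c * residual n Y 1 \<omega>)"
    and c: "real n * c\<^sup>2 = (1 + c)\<^sup>2"
  proof -
    have "real n * c\<^sup>2 = (1 + c)\<^sup>2" if "s * c = 1 + c \<or> s * c = - (1 + c)" for c
      using that by (metis n power2_minus power_mult_distrib)
    moreover have "s * (- (1 / (s + 1))) = - (1 + - (1 / (s + 1)))" "s * (1 / (s - 1)) = 1 + 1 / (s - 1)"
      using s by (simp_all add: field_simps)
    ultimately have "real n * (- (1 / (s + 1)))\<^sup>2 = (1 + - (1 / (s + 1)))\<^sup>2" "real n * (1 / (s - 1))\<^sup>2 = (1 + 1 / (s - 1))\<^sup>2"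
      by blast+
    with assms(6) show ?thesis
      using that[of "- (1 / (s + 1))"] that[of "1 / (s - 1)"] unfolding s_def by auto
  qed
  \<comment> \<open>The entries of the vector with 1 at \<open>j + 1\<close> and \<open>c\<close> at
    1 sum to \<open>1 + c\<close>. Projecting off the all-ones direction subtracts their mean
    \<open>(1 + c) / real n\<close>.\<close>
  define a where "a j i = of_bool (i = j + 1) + c * of_bool (i = 1) - (1 + c) / real n" for j i :: nat
  have W_eq: "W j = (\<lambda>\<omega>. \<Sum>i\<in>{1..n}. a j i * Y i \<omega>)" if "j \<in> {1..n-1}" for j
  proof
    fix \<omega>
    have "(\<Sum>i\<in>{1..n}. a j i * Y i \<omega>) = (\<Sum>i\<in>{1..n}. of_bool (i = j + 1) * Y i \<omega>) +
        c * (\<Sum>i\<in>{1..n}. of_bool (i = 1) * Y i \<omega>) - (1 + c) / real n * (\<Sum>i\<in>{1..n}. Y i \<omega>)"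
      unfolding a_def sum_distrib_left sum.distrib[symmetric] sum_subtractf[symmetric]
      by (intro sum.cong) (auto simp: algebra_simps)
    also have "\<dots> = Y (j + 1) \<omega> + c * Y 1 \<omega> - (1 + c) / real n * (\<Sum>i\<in>{1..n}. Y i \<omega>)"
      using that assms(2) by (simp add: of_bool_def if_distrib[of "\<lambda>x. x * _"] sum.delta cong: if_cong) auto
    also have "\<dots> = W j \<omega>"
      using that by (simp add: W residual_def sample_mean_def algebra_simps add_divide_distrib)
    finally show "W j \<omega> = (\<Sum>i\<in>{1..n}. a j i * Y i \<omega>)" ..
  qed
  \<comment> \<open>This makes the mean of \<open>W j\<close> vanish for every \<open>\<mu>\<close>,
    and it also removes the constant part of \<open>a k\<close> from the inner products
    below.\<close>
  have a_sum: "(\<Sum>i\<in>{1..n}. a j i) = 0" if "j \<in> {1..n-1}" for j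
    using that assms(2)
    by (simp add: a_def sum.distrib sum_subtractf sum_distrib_left[symmetric] of_bool_def sum.delta) auto
  have orth: "(\<Sum>i\<in>{1..n}. a j i * a k i) = of_bool (j = k)" if jk: "j \<in> {1..n-1}" "k \<in> {1..n-1}" for j k
  proof -
    have "(\<Sum>i\<in>{1..n}. a j i * a k i) =
        (\<Sum>i\<in>{1..n}. a j i * (of_bool (i = k + 1) + c * of_bool (i = 1))) -
        (\<Sum>i\<in>{1..n}. a j i) * ((1 + c) / real n)"
      unfolding sum_distrib_right sum_subtractf[symmetric] by (simp add: a_def[of k] algebra_simps)
    also have "\<dots> = (\<Sum>i\<in>{1..n}. a j i * of_bool (i = k + 1)) + c * (\<Sum>i\<in>{1..n}. a j i * of_bool (i = 1))"
      by (simp only: a_sum[OF jk(1)] distrib_left sum.distrib sum_distrib_left mult.left_commute mult_zero_left diff_zero)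
    also have "\<dots> = a j (k + 1) + c * a j 1"
      using jk assms(2) by (simp add: of_bool_def if_distrib[of "\<lambda>x. _ * x"] sum.delta cong: if_cong) auto
    \<comment> \<open>Since \<open>j\<close> and \<open>k\<close> are at least 1, the positions
      \<open>j + 1\<close> and \<open>k + 1\<close> never coincide with 1, so only the diagonal term
      and the terms in \<open>c\<close> survive. The equation for \<open>c\<close> then cancels the
      bracket.\<close>
    also have "\<dots> = of_bool (j = k) + (c\<^sup>2 - (1 + c)\<^sup>2 / real n)"
      using jk assms(2) by (simp add: a_def power2_eq_square field_simps)
    also have "c\<^sup>2 - (1 + c)\<^sup>2 / real n = 0"
      using c assms(2) by (simp add: field_simps)
    finally show ?thesis by simp
  qed
  have normal: "distributed M lborel (Y i) (normal_density \<mu> \<sigma>)" if "i \<in> {1..n}" for i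
    using assms(5) that by (simp add: normal_distributed_def)
  have "indep_vars (\<lambda>_. borel) W {1..n-1}"
    using indep_normal_orthonormal_combination(1)[OF finite_atLeastAtMost assms(3,4) normal finite_atLeastAtMost orth]
    by (subst indep_vars_cong[OF refl W_eq refl]) auto
  moreover have "normal_distributed 0 \<sigma> M (W j)" if "j \<in> {1..n-1}" for j
    using indep_normal_orthonormal_combination(2)[OF finite_atLeastAtMost assms(3,4) normal finite_atLeastAtMost orth, OF _ _ _ that]
    by (simp only: normal_distributed_def W_eq[OF that] a_sum[OF that]) simp
  \<comment> \<open>A pointwise computation: as the residuals sum to 0, the cross terms reduce to a
    multiple of \<open>(?r 1)\<^sup>2\<close>. Its total coefficient
    \<open>(real n - 1) * c\<^sup>2 - 2 * c\<close> equals 1 by the choice of \<open>c\<close>,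
    which supplies the missing square of the first residual.\<close>
  moreover have "(\<Sum>j=1..n-1. (W j \<omega>)\<^sup>2) = (\<Sum>j=1..n. (residual n Y j \<omega>)\<^sup>2)" for \<omega>
  proof -
    let ?r = "\<lambda>i. residual n Y i \<omega>"
    have split: "(\<Sum>i=1..n. f i) = f 1 + (\<Sum>j=1..n-1. f (j + 1))" for f :: "nat \<Rightarrow> real"
    proof -
      have "(\<Sum>i=1..n. f i) = f 1 + (\<Sum>i=Suc 1..Suc (n-1). f i)"
        using assms(2) by (simp add: sum.atLeast_Suc_atMost)
      then show ?thesis
        unfolding sum.shift_bounds_cl_Suc_ivl by simp
    qed
    have "(\<Sum>i=1..n. ?r i) = 0"
      using assms(2) by (simp add: residual_def sum_subtractf sample_mean_def)
    then have r: "(\<Sum>j=1..n-1. ?r (j + 1)) = - ?r 1"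
      using split[of ?r] by simp
    have "(\<Sum>j=1..n-1. (W j \<omega>)\<^sup>2) = (\<Sum>j=1..n-1. (?r (j + 1))\<^sup>2 + 2 * c * ?r 1 * ?r (j + 1) + c\<^sup>2 * (?r 1)\<^sup>2)"
      by (intro sum.cong) (auto simp: W power2_eq_square algebra_simps)
    also have "\<dots> = (\<Sum>j=1..n-1. (?r (j + 1))\<^sup>2) + 2 * c * ?r 1 * (\<Sum>j=1..n-1. ?r (j + 1)) + (real n - 1) * c\<^sup>2 * (?r 1)\<^sup>2"
      using assms(2) by (simp add: sum.distrib sum_distrib_left of_nat_diff)
    also have "\<dots> = (\<Sum>j=1..n-1. (?r (j + 1))\<^sup>2) + (?r 1)\<^sup>2 + (real n * c\<^sup>2 - (1 + c)\<^sup>2) * (?r 1)\<^sup>2"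
      unfolding r by (simp add: power2_eq_square algebra_simps)
    finally show ?thesis
      using c split[of "\<lambda>i. (?r i)\<^sup>2"] by simp
  qed
  ultimately show ?thesis
    by blast
qed

end
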